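(* Let $\mathbf{A} = \mathbf{A}^\mathsf{T} \in \mathbb{R}^{n\times n}$ be symmetric (not necessarily nonsingular), and let $\mathbf{M} = \mathbf{M}^\mathsf{T} \in \mathbb{R}^{n\times n}$ be nonsingular with $\mathbf{A} = \mathbf{M} - \mathbf{N}$. Let $\ell \ge 1$ be an integer, $\mathbf{H} = \mathbf{M}^{-1}\mathbf{N}$, and $\mathbf{C}^{(\ell)} = \sum_{i=0}^{\ell-1}\mathbf{H}^i\mathbf{M}^{-1}$. Assume that $\mathbf{M}$ is definite if $\ell$ is odd, and that $\mathbf{M}+\mathbf{N}$ is definite if $\ell$ is even. Then the MINRES method preconditioned by $\ell$ steps of the inner iterations, i.e., with preconditioning matrix $\mathbf{C}^{(\ell)}$, determines a solution of $\mathbf{A}\mathbf{x} = \mathbf{b}$ for all $\mathbf{b} \in \mathcal{R}(\mathbf{A})$ and for all $\mathbf{x}_0 \in \mathbb{R}^n$.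
   Context: $\mathcal{R}(\cdot)$ denotes the range. A symmetric matrix is definite if it is either positive definite or negative definite. $\mathbf{C}^{(\ell)}$ is the matrix such that $\mathbf{C}^{(\ell)}\mathbf{r}$ is the $\ell$th iterate of the stationary iteration $\mathbf{z}^{(j)} = \mathbf{H}\mathbf{z}^{(j-1)} + \mathbf{M}^{-1}\mathbf{r}$ with $\mathbf{z}^{(0)} = \mathbf{0}$. Krylov subspace: $\mathcal{K}_k(\mathbf{B},\mathbf{v}) = \mathrm{span}\{\mathbf{v},\mathbf{B}\mathbf{v},\dots,\mathbf{B}^{k-1}\mathbf{v}\}$ (with $\mathcal{K}_0=\{\mathbf{0}\}$). MINRES preconditioned by a symmetric positive definite $\mathbf{C}$: with initial iterate $\mathbf{x}_0$ and $\mathbf{r}_0 = \mathbf{b}-\mathbf{A}\mathbf{x}_0$, the $k$th iterate is the $\mathbf{x}_k \in \mathbf{x}_0 + \mathcal{K}_k(\mathbf{C}\mathbf{A}, \mathbf{C}\mathbf{r}_0)$ minimizing $\|\mathbf{C}^{\frac12}(\mathbf{b}-\mathbf{A}\mathbf{x}_k)\|_2$, i.e., MINRES applied to $\mathbf{C}^{\frac12}\mathbf{A}\mathbf{C}^{\frac12}\mathbf{y} = \mathbf{C}^{\frac12}\mathbf{b}$, $\mathbf{x}=\mathbf{C}^{\frac12}\mathbf{y}$. Here $\mathbf{C}=\mathbf{C}^{(\ell)}$ if $\mathbf{C}^{(\ell)}$ is positive definite; if $\mathbf{C}^{(\ell)}$ is negative definite, the method is understood with the sign changed, $\mathbf{C}=-\mathbf{C}^{(\ell)}$.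 "Determines a solution" means: in exact arithmetic, there is some $k \ge 0$ such that the iterate $\mathbf{x}_k$ is well defined and satisfies $\mathbf{A}\mathbf{x}_k=\mathbf{b}$. *)

theory Defs
  imports "HOL-Analysis.Analysis"
begin

(* On the type real^'n^'n multiplication and power act entrywise, so powers of a matrix
   with respect to the matrix product are introduced separately. *)
primrec mat_power :: "real^'n^'n \<Rightarrow> nat \<Rightarrow> real^'n^'n" where
  "mat_power B 0 = mat 1"
| "mat_power B (Suc k) = B ** mat_power B k"

definition symmetric_matrix :: "real^'n^'n \<Rightarrow> bool" where
  "symmetric_matrix B \<longleftrightarrow> transpose B = B"

definition pos_def :: "real^'n^'n \<Rightarrow> bool" where
  "pos_def B \<longleftrightarrow> symmetric_matrix B \<and> (\<forall>x. x \<noteq> 0 \<longrightarrow> x \<bullet> (B *v x) > 0)"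

definition neg_def :: "real^'n^'n \<Rightarrow> bool" where
  "neg_def B \<longleftrightarrow> symmetric_matrix B \<and> (\<forall>x. x \<noteq> 0 \<longrightarrow> x \<bullet> (B *v x) < 0)"

definition definite_matrix :: "real^'n^'n \<Rightarrow> bool" where
  "definite_matrix B \<longleftrightarrow> pos_def B \<or> neg_def B"

(* The principal square root; meaningful only for positive definite C, where it exists and
   is unique. *)
definition mat_sqrt :: "real^'n^'n \<Rightarrow> real^'n^'n" where
  "mat_sqrt C = (THE S. pos_def S \<and> S ** S = C)"

definition inner_precond :: "real^'n^'n \<Rightarrow> real^'n^'n \<Rightarrow> nat \<Rightarrow> real^'n^'n" where
  "inner_precond M N l =
     (\<Sum>i<l. mat_power (matrix_inv M ** N) i ** matrix_inv M)"

primrec stationary_iterate ::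
  "real^'n^'n \<Rightarrow> real^'n^'n \<Rightarrow> real^'n \<Rightarrow> nat \<Rightarrow> real^'n" where
  "stationary_iterate M N r 0 = 0"
| "stationary_iterate M N r (Suc j) =
     (matrix_inv M ** N) *v stationary_iterate M N r j + matrix_inv M *v r"

lemma inner_precond_Suc:
  "inner_precond M N (Suc l) =
     (matrix_inv M ** N) ** inner_precond M N l + matrix_inv M"
proof -
  have "inner_precond M N (Suc l) =
      matrix_inv M + (\<Sum>i<l. (matrix_inv M ** N) ** (mat_power (matrix_inv M ** N) i ** matrix_inv M))"
    by (simp add: inner_precond_def sum.lessThan_Suc_shift matrix_mul_assoc
        del: sum.lessThan_Suc)
  also have "(\<Sum>i<l. (matrix_inv M ** N) ** (mat_power (matrix_inv M ** N) i ** matrix_inv M))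
      = (matrix_inv M ** N) ** inner_precond M N l"
    unfolding inner_precond_def
    by (induction l) (simp_all add: matrix_add_ldistrib)
  finally show ?thesis by (simp add: add.commute)
qed

(* The preconditioner is the operator carried out by l steps of the inner iteration. *)
lemma inner_precond_stationary_iterate:
  "inner_precond M N l *v r = stationary_iterate M N r l"
proof (induction l)
  case 0
  show ?case by (simp add: inner_precond_def)
next
  case (Suc l)
  have "inner_precond M N (Suc l) *v r =
      (matrix_inv M ** N) *v (inner_precond M N l *v r) + matrix_inv M *v r"
    by (simp only: inner_precond_Suc matrix_vector_mult_add_rdistrib matrix_vector_mul_assoc)
  with Suc show ?case by simp
qed

definition krylov :: "nat \<Rightarrow> real^'n^'n \<Rightarrow> real^'n \<Rightarrow> (real^'n) set" where
  "krylov k B v = span ((\<lambda>i. mat_power B i *v v) ` {..<k})"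

(* x is a k-th iterate of MINRES with positive definite preconditioning matrix C *)
definition is_minres_iterate ::
  "real^'n^'n \<Rightarrow> real^'n^'n \<Rightarrow> real^'n \<Rightarrow> real^'n \<Rightarrow> nat \<Rightarrow> real^'n \<Rightarrow> bool" where
  "is_minres_iterate A C b x0 k x \<longleftrightarrow>
     is_arg_min (\<lambda>z. norm (mat_sqrt C *v (b - A *v z)))
       (\<lambda>z. z \<in> (+) x0 ` krylov k (C ** A) (C *v (b - A *v x0))) x"

(* Some iterate is well defined, i.e. the minimizer exists and is unique, and solves A x = b. *)
definition minres_determines_solution ::
  "real^'n^'n \<Rightarrow> real^'n^'n \<Rightarrow> real^'n \<Rightarrow> real^'n \<Rightarrow> bool" where
  "minres_determines_solution A C b x0 \<longleftrightarrow>
     (\<exists>k x. is_minres_iterate A C b x0 k x \<and>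
        (\<forall>y. is_minres_iterate A C b x0 k y \<longrightarrow> y = x) \<and> A *v x = b)"

(* A negative definite C is used with its sign changed; for C not definite the method is
   undefined and determines nothing. *)
definition precond_minres_determines_solution ::
  "real^'n^'n \<Rightarrow> real^'n^'n \<Rightarrow> real^'n \<Rightarrow> real^'n \<Rightarrow> bool" where
  "precond_minres_determines_solution A C b x0 \<longleftrightarrow>
     (pos_def C \<and> minres_determines_solution A C b x0) \<or>
     (neg_def C \<and> minres_determines_solution A (- C) b x0)"

end

theory Submission
  imports Defs
begin

text \<open>With \<open>H = M\<^sup>-\<^sup>1 N\<close> one has \<open>H C\<^bsup>(l)\<^esup> = C\<^bsup>(l)\<^esup> H\<^sup>T\<close>, so
  \<open>C\<^bsup>(l+2)\<^esup> = H C\<^bsup>(l)\<^esup> H\<^sup>T + M\<^sup>-\<^sup>1 (M + N) M\<^sup>-\<^sup>1\<close> and definiteness of \<open>C\<^bsup>(l)\<^esup>\<close> follows by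
  induction in steps of two. For positive definite \<open>C\<close> the union \<open>W\<close> of the Krylov spaces is
  invariant under \<open>C A\<close> and contained in its range, where \<open>A\<close> has trivial kernel because
  \<open>(A u) \<bullet> C (A u) = u \<bullet> A (C A u)\<close>. Hence \<open>C A\<close> is bijective on \<open>W\<close>, which yields exactly one
  solution in \<open>x\<^sub>0 + W\<close>.\<close>

section \<open>Symmetric, definite and inverse matrices\<close>

lemma symmetric_matrix_inner:
  "symmetric_matrix B \<Longrightarrow> x \<bullet> (B *v y) = (B *v x) \<bullet> y"
  by (metis dot_lmul_matrix symmetric_matrix_def vector_transpose_matrix)

lemma symmetric_matrixI:
  assumes "\<And>x y. x \<bullet> (B *v y) = (B *v x) \<bullet> y"
  shows "symmetric_matrix B"
proof -
  have "transpose B *v x = B *v x" for x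
    by (rule vector_eq_rdot[THEN iffD1]) (simp add: assms dot_lmul_matrix)
  then show ?thesis
    by (simp add: symmetric_matrix_def matrix_eq)
qed

lemma
  assumes "invertible B"
  shows matrix_inv_left: "matrix_inv B ** B = mat 1"
    and matrix_inv_right: "B ** matrix_inv B = mat 1"
proof -
  have "B ** matrix_inv B = mat 1 \<and> matrix_inv B ** B = mat 1"
    using assms unfolding invertible_def matrix_inv_def by (rule someI_ex)
  then show "matrix_inv B ** B = mat 1" "B ** matrix_inv B = mat 1"
    by simp_all
qed

lemma pos_def_inner_nonneg: "pos_def B \<Longrightarrow> 0 \<le> x \<bullet> (B *v x)"
  by (cases "x = 0") (auto simp: pos_def_def less_imp_le)

lemma pos_def_kernel: "pos_def B \<Longrightarrow> B *v x = 0 \<Longrightarrow> x = 0"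
  by (metis inner_zero_right less_irrefl pos_def_def)

section \<open>Existence and uniqueness of the positive definite square root\<close>

text \<open>The form attains its minimum \<open>m\<close> on the compact unit sphere, and
  homogeneity carries the bound to all vectors.\<close>

lemma pos_def_bounded_below:
  fixes C :: "real^'n^'n"
  assumes "pos_def C"
  obtains m where "0 < m" "\<And>x. m * (norm x)\<^sup>2 \<le> x \<bullet> (C *v x)"
proof -
  have "compact (sphere (0::real^'n) 1)" "sphere (0::real^'n) 1 \<noteq> {}"
    by simp_all
  moreover have "continuous_on (sphere 0 1) (\<lambda>x. x \<bullet> (C *v x))"
    by (intro continuous_intros matrix_vector_mult_linear_continuous_on)
  ultimately have "\<exists>u\<in>sphere 0 1. \<forall>x\<in>sphere 0 1. u \<bullet> (C *v u) \<le> x \<bullet> (C *v x)"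
    by (rule continuous_attains_inf)
  then obtain u where u: "u \<in> sphere 0 1"
    and min: "\<And>x. x \<in> sphere 0 1 \<Longrightarrow> u \<bullet> (C *v u) \<le> x \<bullet> (C *v x)"
    by blast
  show thesis
  proof (rule that)
    show "0 < u \<bullet> (C *v u)"
    proof -
      have "u \<noteq> 0"
        using u by auto
      then show ?thesis
        using assms by (simp add: pos_def_def)
    qed
    show "u \<bullet> (C *v u) * (norm x)\<^sup>2 \<le> x \<bullet> (C *v x)" for x
    proof (cases "x = 0")
      case False
      have "u \<bullet> (C *v u) \<le> (x /\<^sub>R norm x) \<bullet> (C *v (x /\<^sub>R norm x))"
        using False by (intro min) simp
      also have "\<dots> = x \<bullet> (C *v x) / (norm x)\<^sup>2"
        by (simp add: matrix_vector_mult_scaleR power2_eq_square field_simps)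
      finally show ?thesis
        using False by (simp add: field_simps)
    qed simp
  qed
qed

text \<open>With \<open>m\<close> bounding the form from below and \<open>L\<close> bounding the
  operator, the squared norm shrinks by at least the factor
  \<open>1 - 2 * c * m + c\<^sup>2 * L\<^sup>2\<close>, which is smallest at
  \<open>c = m / L\<^sup>2\<close>.\<close>

lemma pos_def_scaled_contraction:
  fixes C :: "real^'n^'n"
  assumes "pos_def C"
  obtains c \<rho> where "0 < c" "0 \<le> \<rho>" "\<rho> < 1"
    "\<And>x. norm (x - c *\<^sub>R (C *v x)) \<le> \<rho> * norm x"
proof -
  obtain m where m: "0 < m" "\<And>x. m * (norm x)\<^sup>2 \<le> x \<bullet> (C *v x)"
    using pos_def_bounded_below[OF assms] by blast
  obtain L where L: "0 < L" "\<And>x. norm (C *v x) \<le> norm x * L"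
    using bounded_linear.pos_bounded[OF matrix_vector_mul_bounded_linear] by blast
  \<comment> \<open>The maximum with 0 makes \<open>q\<close> a valid radicand without comparing
    \<open>m\<close> and \<open>L\<close>.\<close>
  define q where "q = max 0 (1 - m\<^sup>2 / L\<^sup>2)"
  have q: "0 \<le> q" "q < 1"
    using m(1) L(1) by (auto simp: q_def)
  show thesis
  proof (rule that)
    show "0 < m / L\<^sup>2" "0 \<le> sqrt q" "sqrt q < 1"
      using m(1) L(1) q by simp_all
    show "norm (x - (m / L\<^sup>2) *\<^sub>R (C *v x)) \<le> sqrt q * norm x" for x
    proof -
      define c where "c = m / L\<^sup>2"
      have c: "0 < c"
        using m(1) L(1) by (simp add: c_def)
      have "(norm (x - c *\<^sub>R (C *v x)))\<^sup>2
          = (norm x)\<^sup>2 - 2 * c * (x \<bullet> (C *v x)) + c\<^sup>2 * (norm (C *v x))\<^sup>2"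
        by (simp only: power2_norm_eq_inner)
          (simp add: inner_diff inner_commute power2_eq_square algebra_simps)
      also have "\<dots> \<le> (norm x)\<^sup>2 - 2 * c * (m * (norm x)\<^sup>2) + c\<^sup>2 * (norm x * L)\<^sup>2"
        using c m(2)[of x] power_mono[OF L(2)[of x], of 2]
        by (intro add_mono diff_mono mult_left_mono) simp_all
      also have "\<dots> = (1 - m\<^sup>2 / L\<^sup>2) * (norm x)\<^sup>2"
        using L(1) by (simp add: c_def field_simps power2_eq_square)
      also have "\<dots> \<le> q * (norm x)\<^sup>2"
        by (intro mult_right_mono) (simp_all add: q_def)
      also have "\<dots> = (sqrt q * norm x)\<^sup>2"
        using q by (simp add: power_mult_distrib)
      finally have "norm (x - c *\<^sub>R (C *v x)) \<le> sqrt q * norm x"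
        by (rule power2_le_imp_le) (simp add: q)
      then show ?thesis
        by (simp only: c_def)
    qed
  qed
qed

text \<open>The binomial series for \<open>\<surd>(1 - R)\<close> is replaced by the fixed point of
  \<open>Y \<mapsto> (R + Y\<^sup>2)/2\<close>, for which \<open>(1 - Y)\<^sup>2 = 1 - R\<close>.\<close>
lemma ex_pos_def_sqrt:
  fixes C :: "real^'n^'n"
  assumes "pos_def C"
  shows "\<exists>S. pos_def S \<and> S ** S = C"
proof -
  have symC: "\<And>x y. x \<bullet> (C *v y) = (C *v x) \<bullet> y"
    using assms by (simp add: pos_def_def symmetric_matrix_inner)
  obtain c \<rho> where c: "0 < c" and \<rho>: "0 \<le> \<rho>" "\<rho> < 1"
    and contr: "\<And>x. norm (x - c *\<^sub>R (C *v x)) \<le> \<rho> * norm x"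
    using pos_def_scaled_contraction[OF assms] by blast
  \<comment> \<open>Scaling by \<open>c\<close> gives \<open>R = 1 - c C\<close> norm at most \<rho>
    < 1; the factor is undone by \<open>1 / sqrt c\<close> in \<open>S\<close>.\<close>
  define R where "R = id_blinfun - c *\<^sub>R Blinfun ((*v) C)"
  have R_apply: "R x = x - c *\<^sub>R (C *v x)" for x
    by (simp add: R_def blinfun.bilinear_simps bounded_linear_Blinfun_apply)
  have normR: "norm R \<le> \<rho>"
    using \<rho> contr by (intro norm_blinfun_bound) (simp_all add: R_apply)
  \<comment> \<open>Self-adjointness is built into the closed set, so the fixed point inherits it.
    The ball is preserved because (\<rho> + \<rho> * \<rho>) / 2 \<le> \<rho>.\<close>
  define X where "X = {Y::(real^'n) \<Rightarrow>\<^sub>L (real^'n). norm Y \<le> \<rho> \<and> (\<forall>x y. x \<bullet> blinfun_apply Y y = blinfun_apply Y x \<bullet> y)}"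
  define f where "f Y = (R + (Y o\<^sub>L Y)) /\<^sub>R 2" for Y
  have "\<exists>!Y\<in>X. f Y = Y"
  proof (rule Banach_fix)
    have "closed X"
      unfolding X_def
      by (intro closed_Collect_conj closed_Collect_le closed_Collect_all closed_Collect_eq
          continuous_intros)
    then show "complete X"
      by (simp add: complete_eq_closed)
    show "X \<noteq> {}"
      using \<rho> by (auto simp: X_def intro!: exI[of _ 0])
    show "f ` X \<subseteq> X"
    proof clarify
      fix Y assume Y: "Y \<in> X"
      have "norm (Y o\<^sub>L Y) \<le> \<rho> * 1"
        using Y \<rho> by (intro order_trans[OF norm_blinfun_compose] mult_mono) (auto simp: X_def)
      then have "norm (R + (Y o\<^sub>L Y)) \<le> \<rho> + \<rho>"
        using normR norm_triangle_mono[of R \<rho> "Y o\<^sub>L Y" \<rho>] by simp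
      then have "norm (f Y) \<le> \<rho>"
        by (simp add: f_def)
      moreover have "x \<bullet> f Y y = f Y x \<bullet> y" for x y
      proof -
        have "x \<bullet> Y (Y y) = Y (Y x) \<bullet> y"
          using Y by (simp add: X_def)
        then show ?thesis
          by (simp add: f_def blinfun.bilinear_simps R_apply inner_add inner_diff symC)
      qed
      ultimately show "f Y \<in> X"
        by (simp add: X_def)
    qed
    show "dist (f Y) (f Z) \<le> \<rho> * dist Y Z" if "Y \<in> X" "Z \<in> X" for Y Z
    proof -
      \<comment> \<open>The noncommutative factorization
        \<open>Y\<^sup>2 - Z\<^sup>2 = Y (Y - Z) + (Y - Z) Z\<close> yields the Lipschitz constant
        \<rho>.\<close>
      have "f Y - f Z = ((Y o\<^sub>L (Y - Z)) + ((Y - Z) o\<^sub>L Z)) /\<^sub>R 2"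
        by (rule blinfun_eqI) (simp add: f_def blinfun.bilinear_simps scaleR_diff_right[symmetric])
      moreover have "norm ((Y o\<^sub>L (Y - Z)) + ((Y - Z) o\<^sub>L Z)) \<le> \<rho> * norm (Y - Z) + norm (Y - Z) * \<rho>"
        using that \<rho>
        by (intro norm_triangle_mono order_trans[OF norm_blinfun_compose] mult_mono)
          (auto simp: X_def)
      ultimately show ?thesis
        by (simp add: dist_norm)
    qed
  qed (fact \<rho>)+
  then obtain Y where Y: "Y \<in> X" "f Y = Y"
    by blast
  define S where "S = (1 / sqrt c) *\<^sub>R matrix (\<lambda>x. x - Y x)"
  have "linear (\<lambda>x. x - Y x)"
    by (simp add: blinfun.bilinear_simps linear_iff algebra_simps)
  then have S_apply: "S *v x = (x - Y x) /\<^sub>R sqrt c" for x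
    by (simp add: S_def matrix_works scaleR_matrix_vector_assoc[symmetric] divide_inverse)
  have "pos_def S"
    unfolding pos_def_def
  proof (intro conjI allI impI)
    show "symmetric_matrix S"
      using Y(1) by (intro symmetric_matrixI) (simp add: S_apply inner_diff X_def)
    fix x :: "real^'n" assume "x \<noteq> 0"
    \<comment> \<open>Since \<open>Y\<close> has norm at most \<rho> < 1, \<open>1 - Y\<close> is
      positive definite.\<close>
    have "x \<bullet> Y x \<le> norm x * (\<rho> * norm x)"
      using Y(1) by (intro order_trans[OF norm_cauchy_schwarz] mult_left_mono
          order_trans[OF norm_blinfun] mult_right_mono) (auto simp: X_def)
    also have "\<dots> = \<rho> * (x \<bullet> x)"
      by (simp add: dot_square_norm power2_eq_square)
    also have "\<dots> < 1 * (x \<bullet> x)"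
      using \<rho> \<open>x \<noteq> 0\<close> by (intro mult_strict_right_mono) simp_all
    finally show "0 < x \<bullet> (S *v x)"
      using c by (simp add: S_apply inner_diff)
  qed
  moreover have "S *v (S *v x) = C *v x" for x
  proof -
    have "(R x + Y (Y x)) /\<^sub>R 2 = Y x"
      using arg_cong[OF Y(2), of "\<lambda>Z. Z x"] by (simp add: f_def blinfun.bilinear_simps)
    moreover have "R x + Y (Y x) = 2 *\<^sub>R ((R x + Y (Y x)) /\<^sub>R 2)"
      by simp
    ultimately have "R x + Y (Y x) = 2 *\<^sub>R Y x"
      by (simp only:)
    then have "x - Y x - Y (x - Y x) = c *\<^sub>R (C *v x)"
      by (simp add: R_apply blinfun.bilinear_simps scaleR_2 algebra_simps)
    moreover have "inverse (sqrt c) * (inverse (sqrt c) * c) = 1"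
      using c by (simp add: field_simps)
    ultimately show ?thesis
      by (simp add: S_apply blinfun.bilinear_simps scaleR_diff_right[symmetric])
  qed
  ultimately show ?thesis
    by (metis matrix_eq matrix_vector_mul_assoc)
qed

lemma matrix_add_rdistrib:
  fixes A B :: "'a::semiring_1^'n^'m"
  shows "(A + B) ** C = A ** C + B ** C"
  by (simp add: matrix_matrix_mult_def vec_eq_iff sum.distrib distrib_right)

lemma transpose_add: "transpose (A + B) = transpose A + transpose B"
  by (simp add: transpose_def vec_eq_iff)

lemma trace_eq_sum_inner: "trace (B :: real^'n^'n) = (\<Sum>i\<in>UNIV. axis i 1 \<bullet> (B *v axis i 1))"
  by (simp add: trace_def matrix_vector_mult_basis column_def inner_axis')

text \<open>For \<open>D = S - T\<close> equal squares give \<open>S D + D T = 0\<close>.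
  Multiplying by \<open>D\<close> and taking traces gives trace 0 for \<open>D (S + T) D\<close>, a
  sum of nonnegative values of the form of \<open>S + T\<close> at the columns of \<open>D\<close>;
  hence all columns vanish.\<close>

lemma pos_def_sqrt_unique:
  fixes S T :: "real^'n^'n"
  assumes S: "pos_def S" and T: "pos_def T" and eq: "S ** S = T ** T"
  shows "S = T"
proof -
  define D where "D = S - T"
  have symD: "x \<bullet> (D *v y) = (D *v x) \<bullet> y" for x y
    using S T symmetric_matrix_inner[of S x y] symmetric_matrix_inner[of T x y]
    by (simp add: D_def pos_def_def matrix_vector_mult_diff_rdistrib inner_diff)
  have P: "pos_def (S + T)"
    using S T
    by (auto simp: pos_def_def symmetric_matrix_inner matrix_vector_mult_add_rdistrib inner_add
        intro!: symmetric_matrixI add_pos_pos)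
  have "S ** D + D ** T = 0"
    by (simp add: matrix_eq D_def eq[symmetric] matrix_vector_mul_assoc[symmetric] algebra_simps)
      (simp add: matrix_vector_mul_assoc eq)
  then have "trace (D ** (S ** D)) + trace (D ** (D ** T)) = 0"
    by (simp add: trace_add[symmetric] matrix_add_ldistrib[symmetric]) (simp add: trace_def matrix_matrix_mult_def)
  moreover have "trace (D ** (D ** T)) = trace (D ** (T ** D))"
    by (metis matrix_mul_assoc trace_mul_sym)
  ultimately have "trace (D ** ((S + T) ** D)) = 0"
    by (metis matrix_add_ldistrib matrix_add_rdistrib trace_add)
  moreover have "trace (D ** ((S + T) ** D))
      = (\<Sum>i\<in>UNIV. (D *v axis i 1) \<bullet> ((S + T) *v (D *v axis i 1)))"
    by (simp only: trace_eq_sum_inner matrix_vector_mul_assoc[symmetric] symD)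
  ultimately have "(D *v axis i 1) \<bullet> ((S + T) *v (D *v axis i 1)) = 0" for i
    using P by (simp add: sum_nonneg_eq_0_iff pos_def_inner_nonneg)
  then have "D *v axis i 1 = 0" for i
    using P by (metis less_irrefl pos_def_def)
  then have "D = 0"
    by (simp add: matrix_vector_mult_basis column_def vec_eq_iff)
  then show ?thesis
    by (simp add: D_def)
qed

text \<open>Existence and uniqueness make the description in \<open>mat_sqrt\<close> denote.
  Definiteness lets a vanishing preconditioned residual force a vanishing residual.\<close>

lemma pos_def_mat_sqrt:
  assumes "pos_def C"
  shows "pos_def (mat_sqrt C)"
proof -
  have "\<exists>!S. pos_def S \<and> S ** S = C"
    using ex_pos_def_sqrt[OF assms] pos_def_sqrt_unique by metis
  then show ?thesis
    unfolding mat_sqrt_def by (rule theI'[THEN conjunct1])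
qed

section \<open>Krylov spaces and termination of MINRES\<close>

text \<open>The span of all the vectors has a finite basis among them, and the finitely many
  exponents used lie below some \<open>k\<close>.\<close>

lemma span_krylov_stabilizes:
  obtains k where "krylov k B v = span (range (\<lambda>i. mat_power B i *v v))"
proof -
  let ?f = "\<lambda>i. mat_power B i *v v"
  obtain T where T: "T \<subseteq> range ?f" "independent T" "range ?f \<subseteq> span T"
    using maximal_independent_subset by blast
  then obtain I where I: "finite I" "T = ?f ` I"
    using finite_subset_image[of T ?f UNIV] independent_imp_finite by blast
  then obtain k where "I \<subseteq> {..<k}"
    using finite_nat_bounded by blast
  then have "span T \<subseteq> krylov k B v"
    unfolding krylov_def I(2) by (intro span_mono image_mono)
  moreover have "span (range ?f) \<subseteq> span T"
    using T(3) by (simp add: span_minimal)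
  moreover have "krylov k B v \<subseteq> span (range ?f)"
    unfolding krylov_def by (intro span_mono) blast
  ultimately show thesis
    by (intro that) blast
qed

text \<open>A solution in \<open>x0 + W\<close> has residual 0, so every minimizer has residual 0.
  Two minimizers then differ by an element of \<open>W\<close> in the kernel of \<open>A\<close>,
  that is, by 0.\<close>

lemma minres_pos_def_determines_solution:
  fixes A C :: "real^'n^'n"
  assumes A: "symmetric_matrix A" and C: "pos_def C" and b: "b = A *v z"
  shows "minres_determines_solution A C b x0"
proof -
  define v where "v = C *v (b - A *v x0)"
  define f where "f i = mat_power (C ** A) i *v v" for i
  define W where "W = span (range f)"
  let ?F = "\<lambda>y. C *v (A *v y)"
  have linF: "linear ?F"
    by (simp add: linear_iff algebra_simps)
  have f_0: "f 0 = v" and f_Suc: "f (Suc i) = ?F (f i)" for i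
    by (simp_all add: f_def matrix_vector_mul_assoc matrix_mul_assoc)
  \<comment> \<open>Consistency enters here: \<open>v = C A (z - x0)\<close>, so even the first
    generator lies in the range of \<open>C A\<close>.\<close>
  have "range f \<subseteq> range ?F"
  proof clarify
    show "f i \<in> range ?F" for i
      by (cases i) (auto simp: f_0 f_Suc v_def b matrix_vector_mult_diff_distrib[symmetric])
  qed
  then have W_range: "W \<subseteq> range ?F"
    unfolding W_def by (intro span_minimal linear_subspace_image[OF linF]) auto
  have W_kernel: "y = 0" if "y \<in> W" "A *v y = 0" for y
  proof -
    have "y \<in> range ?F"
      using W_range that(1) by (rule subsetD)
    then obtain u where u: "y = ?F u"
      by (elim rangeE)
    then have "(A *v u) \<bullet> (C *v (A *v u)) = 0"
      using that(2) symmetric_matrix_inner[OF A, of u y] by simp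
    then have "A *v u = 0"
      using C by (metis less_irrefl pos_def_def)
    then show "y = 0"
      by (simp add: u)
  qed
  have W_sub: "subspace W" and span_W: "span W = W"
    by (simp_all add: W_def)
  have "inj_on ?F W"
    using W_kernel pos_def_kernel[OF C]
    by (subst linear_injective_on_subspace_0[OF linF W_sub]) blast
  moreover have "?F ` W \<subseteq> W"
  proof -
    have "?F ` range f \<subseteq> range f"
      by (auto simp: f_Suc[symmetric])
    then show ?thesis
      unfolding W_def linear_span_image[OF linF, symmetric] by (rule span_mono)
  qed
  \<comment> \<open>An injective linear map of the finite-dimensional space \<open>W\<close> into
    itself is onto.\<close>
  ultimately have "?F ` W = W"
    using W_sub dim_image_eq[OF linF, of W] span_W
    by (intro subspace_dim_equal linear_subspace_image[OF linF]) simp_all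
  moreover have "v \<in> W"
    by (metis W_def f_0 rangeI span_base)
  ultimately have "v \<in> ?F ` W"
    by (simp only:)
  then obtain y where y: "y \<in> W" "?F y = v"
    by (elim imageE) simp
  then have "C *v (A *v y - (b - A *v x0)) = 0"
    by (simp add: v_def matrix_vector_mult_diff_distrib)
  then have "A *v y - (b - A *v x0) = 0"
    by (rule pos_def_kernel[OF C])
  then have sol: "A *v (x0 + y) = b"
    by (simp add: matrix_vector_right_distrib algebra_simps)
  obtain k where k: "krylov k (C ** A) v = W"
    using span_krylov_stabilizes unfolding W_def f_def by blast
  have "is_minres_iterate A C b x0 k (x0 + y)"
    using y(1) by (simp add: is_minres_iterate_def is_arg_min_def v_def[symmetric] k sol)
  moreover have "x = x0 + y" if "is_minres_iterate A C b x0 k x" for x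
  proof -
    have x: "x \<in> (+) x0 ` W"
      and "\<not> norm (mat_sqrt C *v (b - A *v (x0 + y))) < norm (mat_sqrt C *v (b - A *v x))"
      using that imageI[OF y(1), of "(+) x0"]
      unfolding is_minres_iterate_def is_arg_min_def v_def[symmetric] k by blast+
    from x obtain w where w: "w \<in> W" "x = x0 + w"
      by (elim imageE)
    from \<open>\<not> _ < _\<close> have "mat_sqrt C *v (b - A *v x) = 0"
      by (simp add: sol)
    then have "b - A *v x = 0"
      by (rule pos_def_kernel[OF pos_def_mat_sqrt[OF C]])
    then have "A *v (w - y) = 0"
      using sol by (simp add: w(2) matrix_vector_right_distrib matrix_vector_mult_diff_distrib)
    then have "w - y = 0"
      by (rule W_kernel[OF subspace_diff[OF W_sub w(1) y(1)]])
    then show ?thesis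
      by (simp add: w(2))
  qed
  ultimately show ?thesis
    unfolding minres_determines_solution_def using sol by (intro exI conjI allI impI)
qed

section \<open>Symmetry and definiteness of the inner-iteration preconditioner\<close>

lemma symmetric_matrix_inv:
  fixes M :: "real^'n^'n"
  assumes "symmetric_matrix M" "invertible M"
  shows "symmetric_matrix (matrix_inv M)"
proof (rule symmetric_matrixI)
  fix x y
  have M_inv: "M *v (matrix_inv M *v u) = u" for u
    by (simp add: matrix_vector_mul_assoc matrix_inv_right[OF assms(2)])
  show "x \<bullet> (matrix_inv M *v y) = (matrix_inv M *v x) \<bullet> y"
    using symmetric_matrix_inner[OF assms(1), of "matrix_inv M *v x" "matrix_inv M *v y"]
    by (simp add: M_inv)
qed

lemma inner_precond_commute:
  "(matrix_inv M ** N) ** inner_precond M N l = inner_precond M N l ** (N ** matrix_inv M)"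
proof (induction l)
  case 0
  show ?case
    by (simp add: inner_precond_def)
next
  case (Suc l)
  show ?case
    by (simp only: inner_precond_Suc matrix_add_ldistrib matrix_add_rdistrib Suc matrix_mul_assoc)
qed

text \<open>Transposing the recursion \<open>H C + matrix_inv M\<close> turns \<open>H C\<close>
  into \<open>C\<close> times the transpose of \<open>H\<close>, and
  \<open>inner_precond_commute\<close> identifies the two.\<close>

lemma symmetric_inner_precond:
  assumes "symmetric_matrix M" "symmetric_matrix N" "invertible M"
  shows "symmetric_matrix (inner_precond M N l)"
proof (induction l)
  case 0
  show ?case
    by (intro symmetric_matrixI) (simp add: inner_precond_def)
next
  case (Suc l)
  have "transpose (inner_precond M N (Suc l))
      = inner_precond M N l ** (N ** matrix_inv M) + matrix_inv M"
    using assms Suc symmetric_matrix_inv[OF assms(1,3)]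
    by (simp add: inner_precond_Suc symmetric_matrix_def matrix_transpose_mul transpose_add)
  then show ?case
    by (simp add: symmetric_matrix_def inner_precond_Suc inner_precond_commute)
qed

text \<open>This is the two-step recursion as a quadratic form: the transpose of \<open>H\<close>
  maps \<open>x\<close> to \<open>N *v g\<close>, and the added term is the form of
  \<open>M + N\<close> at \<open>g\<close>.\<close>

lemma inner_precond_form_step:
  fixes M N :: "real^'n^'n" and x :: "real^'n"
  assumes "symmetric_matrix M" "symmetric_matrix N" "invertible M"
  defines "g \<equiv> matrix_inv M *v x"
  shows "x \<bullet> (inner_precond M N (Suc (Suc l)) *v x)
    = (N *v g) \<bullet> (inner_precond M N l *v (N *v g)) + g \<bullet> ((M + N) *v g)"
proof -
  let ?G = "matrix_inv M"
  have x: "M *v g = x"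
    by (simp add: g_def matrix_vector_mul_assoc matrix_inv_right assms(3))
  have H: "x \<bullet> (?G *v (N *v v)) = (N *v g) \<bullet> v" for v
    using symmetric_matrix_inner[OF symmetric_matrix_inv[OF assms(1,3)]]
      symmetric_matrix_inner[OF assms(2)]
    by (simp add: g_def)
  have comm: "?G *v (N *v (inner_precond M N l *v x)) = inner_precond M N l *v (N *v g)"
    using inner_precond_commute[of M N l] unfolding g_def
    by (simp add: matrix_vector_mul_assoc matrix_mul_assoc)
  have "inner_precond M N (Suc (Suc l)) *v x
      = ?G *v (N *v (inner_precond M N l *v (N *v g))) + ?G *v (N *v g) + g"
    by (simp only: inner_precond_Suc matrix_vector_mult_add_rdistrib matrix_vector_right_distrib
        matrix_vector_mul_assoc[symmetric] comm g_def[symmetric])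
  then have "x \<bullet> (inner_precond M N (Suc (Suc l)) *v x)
      = (N *v g) \<bullet> (inner_precond M N l *v (N *v g)) + (N *v g) \<bullet> g + x \<bullet> g"
    by (simp add: inner_add H)
  then show ?thesis
    by (simp add: matrix_vector_mult_add_rdistrib inner_add inner_commute x)
qed

text \<open>The sign \<open>s\<close> treats the positive and the negative definite case together.\<close>
lemma inner_precond_form_even:
  fixes M N :: "real^'n^'n"
  assumes "symmetric_matrix M" "symmetric_matrix N" "invertible M"
    and pos: "\<And>g. g \<noteq> 0 \<Longrightarrow> 0 < s * (g \<bullet> ((M + N) *v g))"
    and "x \<noteq> 0"
  shows "0 < s * (x \<bullet> (inner_precond M N (2 * Suc m) *v x))"
proof -
  have step: "0 < s * (x \<bullet> (inner_precond M N (Suc (Suc l)) *v x))"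
    if "\<And>y. 0 \<le> s * (y \<bullet> (inner_precond M N l *v y))" "x \<noteq> 0" for x l
  proof -
    have "matrix_inv M *v x \<noteq> 0"
      using that(2) matrix_inv_right[OF assms(3)]
      by (metis matrix_vector_mul_assoc matrix_vector_mul_lid matrix_vector_mult_0_right)
    then show ?thesis
      unfolding inner_precond_form_step[OF assms(1-3)] distrib_left
      by (intro add_nonneg_pos that(1) pos)
  qed
  \<comment> \<open>The induction starts from the zero matrix at \<open>l = 0\<close>, so it can
    carry only nonnegativity; one further step makes the form strict.\<close>
  have "0 \<le> s * (x \<bullet> (inner_precond M N (2 * m) *v x))" for x
  proof (induction m arbitrary: x)
    case 0
    show ?case
      by (simp add: inner_precond_def)
  next
    case (Suc m)
    then show ?case
      using step[of "2 * m" x] by (cases "x = 0") (auto intro: less_imp_le)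
  qed
  then show ?thesis
    using step[of "2 * m" x] \<open>x \<noteq> 0\<close> by simp
qed

text \<open>The bound reflects
  \<open>1 + t + \<dots> + t\<^bsup>2m\<^esup> = (1 + t\<^bsup>2m\<^esup> + (1 + t)\<^sup>2 (1 + t\<^sup>2 + \<dots> + t\<^bsup>2m-2\<^esup>)) / 2 \<ge> 1/2\<close>.\<close>
lemma inner_precond_form_odd:
  fixes M N :: "real^'n^'n"
  assumes "symmetric_matrix M" "symmetric_matrix N" "invertible M"
    and nonneg: "\<And>g. 0 \<le> s * (g \<bullet> (M *v g))"
  shows "s * (x \<bullet> (matrix_inv M *v x)) \<le> 2 * (s * (x \<bullet> (inner_precond M N (Suc (2 * m)) *v x)))"
proof (induction m arbitrary: x)
  case 0
  let ?g = "matrix_inv M *v x"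
  have "M *v ?g = x"
    by (simp add: matrix_vector_mul_assoc matrix_inv_right assms(3))
  then show ?case
    using nonneg[of ?g] by (simp add: inner_precond_def inner_commute)
next
  case (Suc m)
  define g where "g = matrix_inv M *v x"
  define h where "h = matrix_inv M *v (N *v g)"
  have x: "M *v g = x" and Mh: "M *v h = N *v g"
    by (simp_all add: g_def h_def matrix_vector_mul_assoc matrix_mul_assoc matrix_inv_right assms(3))
  have "h \<bullet> x = g \<bullet> (N *v g)"
    using symmetric_matrix_inner[OF assms(1), of h g] by (simp add: x Mh inner_commute)
  \<comment> \<open>With \<open>h = H g\<close>, this is the form of \<open>M\<close> at
    \<open>(1 + H) g\<close>, the counterpart of the factor \<open>(1 + t)\<^sup>2\<close>. Its
    nonnegativity is exactly the gap left after applying the induction hypothesis at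
    \<open>N *v g\<close>.\<close>
  then have "(g + h) \<bullet> (M *v (g + h)) = g \<bullet> x + 2 * (g \<bullet> (N *v g)) + h \<bullet> (N *v g)"
    by (simp add: matrix_vector_right_distrib inner_add x Mh)
  then have "0 \<le> s * (g \<bullet> x + 2 * (g \<bullet> (N *v g)) + h \<bullet> (N *v g))"
    using nonneg[of "g + h"] by simp
  moreover have "s * (h \<bullet> (N *v g))
      \<le> 2 * (s * ((N *v g) \<bullet> (inner_precond M N (Suc (2 * m)) *v (N *v g))))"
    using Suc[of "N *v g"] by (simp add: h_def[symmetric] inner_commute)
  moreover have "x \<bullet> (inner_precond M N (Suc (2 * Suc m)) *v x)
      = (N *v g) \<bullet> (inner_precond M N (Suc (2 * m)) *v (N *v g)) + (g \<bullet> x + g \<bullet> (N *v g))"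
    using inner_precond_form_step[OF assms(1-3), of x "Suc (2 * m)"]
    by (simp add: g_def[symmetric] matrix_vector_mult_add_rdistrib inner_add x)
  ultimately show ?case
    by (simp add: g_def[symmetric] inner_commute algebra_simps)
qed

text \<open>For even \<open>l\<close>, \<open>l \<ge> 1\<close> excludes the zero matrix at
  \<open>l = 0\<close>. For odd \<open>l\<close>, the form of \<open>matrix_inv M\<close> at
  \<open>x\<close> is that of \<open>M\<close> at \<open>matrix_inv M *v x\<close>, and half of it
  bounds the form of the preconditioner from below.\<close>

lemma inner_precond_form_pos:
  fixes M N :: "real^'n^'n"
  assumes "symmetric_matrix M" "symmetric_matrix N" "invertible M" "l \<ge> 1"
    and odd: "\<And>g. odd l \<Longrightarrow> g \<noteq> 0 \<Longrightarrow> 0 < s * (g \<bullet> (M *v g))"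
    and even: "\<And>g. even l \<Longrightarrow> g \<noteq> 0 \<Longrightarrow> 0 < s * (g \<bullet> ((M + N) *v g))"
    and "x \<noteq> 0"
  shows "0 < s * (x \<bullet> (inner_precond M N l *v x))"
proof (cases "even l")
  case True
  then obtain m where "l = 2 * Suc m"
    using \<open>l \<ge> 1\<close> by (metis dvdE mult_0_right not_one_le_zero old.nat.exhaust)
  then show ?thesis
    using inner_precond_form_even[OF assms(1-3) even \<open>x \<noteq> 0\<close>] True by simp
next
  case False
  then obtain m where m: "l = Suc (2 * m)"
    by (elim oddE) simp
  let ?g = "matrix_inv M *v x"
  have g: "M *v ?g = x"
    by (simp add: matrix_vector_mul_assoc matrix_inv_right assms(3))
  with \<open>x \<noteq> 0\<close> have "?g \<noteq> 0"
    by auto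
  then have "0 < s * (x \<bullet> ?g)"
    using odd[OF False] g by (metis inner_commute)
  moreover have "0 \<le> s * (u \<bullet> (M *v u))" for u
    using odd[OF False, of u] by (cases "u = 0") auto
  ultimately show ?thesis
    using inner_precond_form_odd[OF assms(1-3), of s x m] m by simp
qed

lemma definite_matrixE:
  assumes "definite_matrix B"
  obtains s :: real where "s = 1 \<or> s = -1" "\<And>x. x \<noteq> 0 \<Longrightarrow> 0 < s * (x \<bullet> (B *v x))"
  using assms that[of 1] that[of "-1"]
  by (auto simp: definite_matrix_def pos_def_def neg_def_def)

theorem theorem2p8:
  fixes A M N :: "real^'n^'n" and l :: nat
  assumes "symmetric_matrix A"
    and "symmetric_matrix M"
    and "invertible M"
    and "A = M - N"
    and "l \<ge> 1"
    and "odd l \<Longrightarrow> definite_matrix M"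
    and "even l \<Longrightarrow> definite_matrix (M + N)"
  shows "\<forall>b \<in> range ((*v) A). \<forall>x0.
    precond_minres_determines_solution A (inner_precond M N l) b x0"
proof (intro ballI allI)
  fix b x0 assume "b \<in> range ((*v) A)"
  then obtain z where b: "b = A *v z"
    by blast
  have N: "symmetric_matrix N"
  proof (rule symmetric_matrixI)
    have "N = M - A"
      using assms(4) by simp
    then show "x \<bullet> (N *v y) = (N *v x) \<bullet> y" for x y
      using symmetric_matrix_inner[OF assms(1), of x y] symmetric_matrix_inner[OF assms(2), of x y]
      by (simp add: matrix_vector_mult_diff_rdistrib inner_diff)
  qed
  define C where "C = inner_precond M N l"
  have C: "symmetric_matrix C"
    unfolding C_def by (rule symmetric_inner_precond[OF assms(2) N assms(3)])
  have "definite_matrix (if odd l then M else M + N)"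
    using assms(6,7) by simp
  then obtain s :: real where s: "s = 1 \<or> s = -1"
    and pos: "\<And>g. g \<noteq> 0 \<Longrightarrow> 0 < s * (g \<bullet> ((if odd l then M else M + N) *v g))"
    by (rule definite_matrixE) blast
  have "0 < s * (x \<bullet> (C *v x))" if "x \<noteq> 0" for x
    unfolding C_def using pos that
    by (intro inner_precond_form_pos[OF assms(2) N assms(3,5)]) (simp_all split: if_splits)
  \<comment> \<open>For \<open>s = -1\<close> the method runs with \<open>- C\<close>, so
    definiteness of both signs is recorded.\<close>
  with s have "pos_def C \<or> (neg_def C \<and> pos_def (- C))"
  proof (elim disjE)
    assume s: "s = -1" and C_neg: "\<And>x. x \<noteq> 0 \<Longrightarrow> 0 < s * (x \<bullet> (C *v x))"
    have minus: "(- C) *v x = - (C *v x)" for x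
      using matrix_vector_mult_diff_rdistrib[of 0 C x] by simp
    have "symmetric_matrix (- C)"
      using symmetric_matrix_inner[OF C] by (intro symmetric_matrixI) (simp add: minus)
    with C C_neg show ?thesis
      by (simp add: pos_def_def neg_def_def minus s)
  qed (simp add: pos_def_def C)
  then show "precond_minres_determines_solution A (inner_precond M N l) b x0"
    unfolding precond_minres_determines_solution_def C_def[symmetric]
    using minres_pos_def_determines_solution[OF assms(1) _ b] by blast
qed

end
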